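(* For $i\in\{1,2\}$, let $\Gamma_i$ be a finite simple graph of order $n_i$, let $k_i$ be an integer, and let $\Pi_{r_i}(\Gamma_i)$ be a partition of $\Gamma_i$ into $r_i\ge 1$ global defensive $k_i$-alliances, where $r_1\le r_2$. Let $x_i=\min_{X\in\Pi_{r_i}(\Gamma_i)}|X|$. Then (i) $\gamma_{k_1+k_2}^{d}(\Gamma_1\times\Gamma_2)\le \min\{x_1n_2,\ x_2n_1\}$; (ii) $\psi_{k_1+k_2}^{gd}(\Gamma_1\times\Gamma_2)\ge \max\{\psi_{k_1}^{gd}(\Gamma_1),\ \psi_{k_2}^{gd}(\Gamma_2)\}$.
   Context: For a finite simple graph $\Gamma=(V,E)$, $X\subseteq V$ and $v\in V$, $\delta_X(v)$ is the number of neighbors of $v$ in $X$; $\bar S=V\setminus S$. A nonempty set $S\subseteq V$ is a defensive $k$-alliance if $\delta_S(v)\ge\delta_{\bar S}(v)+k$ for every $v\in S$. It is a global defensive $k$-alliance if moreover it is a dominating set, i.e. $\delta_S(u)>0$ for every $u\in\bar S$. $\gamma_k^d(\Gamma)$ is the minimum cardinality of a global defensive $k$-alliance in $\Gamma$ (when one exists). A partition of $\Gamma$ into $r$ global defensive $k$-alliances is a partition of $V$ into $r$ sets each of which is a global defensive $k$-alliance, and $\psi_k^{gd}(\Gamma)$ is the maximum number of sets in such a partition. $\Gamma_1\times\Gamma_2$ denotes the Cartesian product: its vertex set is $V(\Gamma_1)\times V(\Gamma_2)$, and $(u,v)$ is adjacent to $(u',v')$ if and only if either $u=u'$ and $v$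 is adjacent to $v'$ in $\Gamma_2$, or $v=v'$ and $u$ is adjacent to $u'$ in $\Gamma_1$. *)

theory Defs
  imports
    "Graph_Theory.Pair_Digraph"
    "HOL-Library.Disjoint_Sets"
    "HOL-Library.Extended_Nat"
begin

(* A finite simple graph is a pair_graph: finitely many vertices and a symmetric,
   loop-free arc relation on them, each undirected edge giving both of its arcs. *)

definition nbr_count :: "'a pair_pre_digraph \<Rightarrow> 'a set \<Rightarrow> 'a \<Rightarrow> nat" where
  "nbr_count G X v = card {u \<in> X. (v, u) \<in> parcs G}"

definition defensive_alliance :: "'a pair_pre_digraph \<Rightarrow> int \<Rightarrow> 'a set \<Rightarrow> bool" where
  "defensive_alliance G k S \<longleftrightarrow>
     S \<subseteq> pverts G \<and> S \<noteq> {} \<and>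
     (\<forall>v\<in>S. int (nbr_count G S v) \<ge> int (nbr_count G (pverts G - S) v) + k)"

definition dominating_set :: "'a pair_pre_digraph \<Rightarrow> 'a set \<Rightarrow> bool" where
  "dominating_set G S \<longleftrightarrow> S \<subseteq> pverts G \<and> (\<forall>u \<in> pverts G - S. nbr_count G S u > 0)"

definition global_defensive_alliance :: "'a pair_pre_digraph \<Rightarrow> int \<Rightarrow> 'a set \<Rightarrow> bool" where
  "global_defensive_alliance G k S \<longleftrightarrow> defensive_alliance G k S \<and> dominating_set G S"

(* The infimum is attained whenever some global defensive k-alliance exists; otherwise the
   value is \<infinity>, so a finite upper bound includes the existence of such an alliance. *)
definition global_alliance_number :: "'a pair_pre_digraph \<Rightarrow> int \<Rightarrow> enat" where
  "global_alliance_number G k = (INF S \<in> {S. global_defensive_alliance G k S}. enat (card S))"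

definition global_alliance_partition :: "'a pair_pre_digraph \<Rightarrow> int \<Rightarrow> 'a set set \<Rightarrow> bool" where
  "global_alliance_partition G k P \<longleftrightarrow>
     partition_on (pverts G) P \<and> (\<forall>S\<in>P. global_defensive_alliance G k S)"

(* On a finite graph the supremum is a maximum when such a partition exists; it is 0 otherwise. *)
definition global_alliance_partition_number :: "'a pair_pre_digraph \<Rightarrow> int \<Rightarrow> nat" where
  "global_alliance_partition_number G k = (SUP P \<in> {P. global_alliance_partition G k P}. card P)"

definition cartesian_product ::
    "'a pair_pre_digraph \<Rightarrow> 'b pair_pre_digraph \<Rightarrow> ('a \<times> 'b) pair_pre_digraph" where
  "cartesian_product G H =
     \<lparr> pverts = pverts G \<times> pverts H,
       parcs = {((u, v), (u', v')) | u v u' v'.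
         u \<in> pverts G \<and> v \<in> pverts H \<and> u' \<in> pverts G \<and> v' \<in> pverts H \<and>
         (u = u' \<and> (v, v') \<in> parcs H \<or> v = v' \<and> (u, u') \<in> parcs G)} \<rparr>"

end

theory Submission
  imports Defs
begin

text \<open>
  In the Cartesian product a vertex \<open>(u, v)\<close> moves in one coordinate at a time, so its neighbours
  in a rectangle \<open>S \<times> T\<close> containing it number \<open>\<delta>\<^sub>S(u) + \<delta>\<^sub>T(v)\<close>, and its neighbours off the
  rectangle number the same sum for the complements of \<open>S\<close> and \<open>T\<close>. The defining inequalities of a
  defensive \<open>k\<^sub>1\<close>-alliance \<open>S\<close> and a defensive \<open>k\<^sub>2\<close>-alliance \<open>T\<close> therefore add up to the one for
  \<open>S \<times> T\<close> and \<open>k\<^sub>1 + k\<^sub>2\<close> (\<open>defensive_alliance_Times\<close>).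

  Domination does not multiply in this way: a vertex that misses the rectangle in both coordinates
  has no neighbour in it. Domination does survive when one factor is the whole vertex set
  (\<open>dominating_set_Times\<close>). The whole vertex set of a graph that can be partitioned into defensive
  \<open>k\<close>-alliances is itself one, since enlarging an alliance only helps those vertices already in it
  and every vertex is in some part (\<open>global_alliance_partition_trivial\<close>). So each part \<open>S\<close> of a
  partition of \<open>\<Gamma>\<^sub>1\<close> gives the global alliance \<open>S \<times> V(\<Gamma>\<^sub>2)\<close>, and all the parts together give a
  partition of the product with equally many parts. The former bounds the alliance number when \<open>S\<close>
  is a smallest part; the latter bounds the partition number when the partition is a largest one.
  The roles of the two factors can be exchanged.
\<close>

section \<open>Neighbours in a Cartesian product\<close>

lemma pverts_cartesian_product [simp]:
  "pverts (cartesian_product G H) = pverts G \<times> pverts H"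
  by (simp add: cartesian_product_def)

lemma nbr_count_Diff:
  assumes "finite A" "S \<subseteq> A"
  shows "nbr_count G A v = nbr_count G S v + nbr_count G (A - S) v"
proof -
  have "{u \<in> A. (v, u) \<in> parcs G}
      = {u \<in> S. (v, u) \<in> parcs G} \<union> {u \<in> A - S. (v, u) \<in> parcs G}"
    using assms(2) by blast
  moreover have "finite S" "finite (A - S)"
    using assms by (auto intro: finite_subset)
  ultimately show ?thesis
    unfolding nbr_count_def by (auto intro!: card_Un_disjoint)
qed

text \<open>Moving in the second coordinate stays in \<open>S \<times> T\<close> only if \<open>u \<in> S\<close>, and moving in the first
  only if \<open>v \<in> T\<close>. No neighbour arises in both ways because \<open>G\<close> has no loops.\<close>

lemma nbr_count_Times:
  assumes G: "pair_graph G" and H: "pair_graph H"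
    and S: "S \<subseteq> pverts G" and T: "T \<subseteq> pverts H"
    and u: "u \<in> pverts G" and v: "v \<in> pverts H"
  shows "nbr_count (cartesian_product G H) (S \<times> T) (u, v)
       = (if v \<in> T then nbr_count G S u else 0) + (if u \<in> S then nbr_count H T v else 0)"
proof -
  interpret G: pair_graph G by fact
  interpret H: pair_graph H by fact
  define A where "A = (if v \<in> T then (\<lambda>u'. (u', v)) ` {u' \<in> S. (u, u') \<in> parcs G} else {})"
  define B where "B = (if u \<in> S then (\<lambda>v'. (u, v')) ` {v' \<in> T. (v, v') \<in> parcs H} else {})"
  have fin: "finite S" "finite T"
    using S T G.pair_finite_verts H.pair_finite_verts by (auto intro: finite_subset)
  have "{w \<in> S \<times> T. ((u, v), w) \<in> parcs (cartesian_product G H)} = A \<union> B"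
    using S T u v by (auto simp: A_def B_def cartesian_product_def split: if_splits)
  moreover have "finite A" "finite B"
    using fin by (auto simp: A_def B_def)
  moreover have "A \<inter> B = {}"
    using G.pair_no_loops[of "(u, u)"] by (auto simp: A_def B_def split: if_splits)
  moreover have "card A = (if v \<in> T then nbr_count G S u else 0)"
    by (simp add: A_def nbr_count_def card_image inj_on_def)
  moreover have "card B = (if u \<in> S then nbr_count H T v else 0)"
    by (simp add: B_def nbr_count_def card_image inj_on_def)
  ultimately show ?thesis
    by (simp add: nbr_count_def card_Un_disjoint)
qed

section \<open>Products of alliances\<close>

lemma defensive_alliance_Times:
  assumes G: "pair_graph G" and H: "pair_graph H"
    and S: "defensive_alliance G k S" and T: "defensive_alliance H l T"
  shows "defensive_alliance (cartesian_product G H) (k + l) (S \<times> T)"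
proof -
  interpret G: pair_graph G by fact
  interpret H: pair_graph H by fact
  have sub: "S \<subseteq> pverts G" "T \<subseteq> pverts H" "S \<noteq> {}" "T \<noteq> {}"
    using S T by (auto simp: defensive_alliance_def)
  have "int (nbr_count (cartesian_product G H) (pverts G \<times> pverts H - S \<times> T) (u, v)) + (k + l)
      \<le> int (nbr_count (cartesian_product G H) (S \<times> T) (u, v))"
    if "u \<in> S" "v \<in> T" for u v
  proof -
    have uv: "u \<in> pverts G" "v \<in> pverts H"
      using that sub by auto
    have "nbr_count (cartesian_product G H) (S \<times> T) (u, v) = nbr_count G S u + nbr_count H T v"
      using nbr_count_Times[OF G H sub(1,2) uv] that by simp
    moreover have "nbr_count (cartesian_product G H) (pverts G \<times> pverts H) (u, v)
        = nbr_count G (pverts G) u + nbr_count H (pverts H) v"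
      using nbr_count_Times[OF G H subset_refl subset_refl uv] uv by simp
    moreover have "nbr_count (cartesian_product G H) (pverts G \<times> pverts H) (u, v)
        = nbr_count (cartesian_product G H) (S \<times> T) (u, v)
        + nbr_count (cartesian_product G H) (pverts G \<times> pverts H - S \<times> T) (u, v)"
      using sub by (intro nbr_count_Diff) auto
    moreover have "nbr_count G (pverts G) u = nbr_count G S u + nbr_count G (pverts G - S) u"
      using sub by (intro nbr_count_Diff) auto
    moreover have "nbr_count H (pverts H) v = nbr_count H T v + nbr_count H (pverts H - T) v"
      using sub by (intro nbr_count_Diff) auto
    moreover have "int (nbr_count G (pverts G - S) u) + k \<le> int (nbr_count G S u)"
      using S that by (auto simp: defensive_alliance_def)
    moreover have "int (nbr_count H (pverts H - T) v) + l \<le> int (nbr_count H T v)"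
      using T that by (auto simp: defensive_alliance_def)
    ultimately show ?thesis
      by linarith
  qed
  then show ?thesis
    using sub by (auto simp: defensive_alliance_def)
qed

text \<open>If \<open>T\<close> is all of \<open>V(H)\<close>, a vertex outside \<open>S \<times> T\<close> misses it in the first coordinate only, so
  a neighbour of that coordinate in \<open>S\<close> is enough; likewise if \<open>S\<close> is all of \<open>V(G)\<close>.\<close>

lemma dominating_set_Times:
  assumes G: "pair_graph G" and H: "pair_graph H"
    and S: "dominating_set G S" and T: "dominating_set H T"
    and full: "S = pverts G \<or> T = pverts H"
  shows "dominating_set (cartesian_product G H) (S \<times> T)"
proof -
  have sub: "S \<subseteq> pverts G" "T \<subseteq> pverts H"
    using S T by (auto simp: dominating_set_def)
  have "nbr_count (cartesian_product G H) (S \<times> T) w > 0"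
    if w: "w \<in> pverts G \<times> pverts H - S \<times> T" for w
  proof -
    obtain u v where uv: "w = (u, v)" "u \<in> pverts G" "v \<in> pverts H" "(u, v) \<notin> S \<times> T"
      using w by auto
    have "u \<notin> S \<Longrightarrow> nbr_count G S u > 0" "v \<notin> T \<Longrightarrow> nbr_count H T v > 0"
      using S T uv by (auto simp: dominating_set_def)
    moreover have "u \<in> S \<and> v \<notin> T \<or> u \<notin> S \<and> v \<in> T"
      using full uv by auto
    ultimately show ?thesis
      unfolding uv(1) nbr_count_Times[OF G H sub uv(2,3)] by auto
  qed
  moreover have "S \<times> T \<subseteq> pverts G \<times> pverts H"
    using sub by (rule Sigma_mono)
  ultimately show ?thesis
    unfolding dominating_set_def pverts_cartesian_product by (intro conjI ballI)
qed

lemma global_defensive_alliance_Times: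
  assumes "pair_graph G" "pair_graph H"
    and "global_defensive_alliance G k S" "global_defensive_alliance H l T"
    and "S = pverts G \<or> T = pverts H"
  shows "global_defensive_alliance (cartesian_product G H) (k + l) (S \<times> T)"
  using assms defensive_alliance_Times[of G H k S l T] dominating_set_Times[of G H S T]
  by (simp add: global_defensive_alliance_def)

section \<open>Partitions into global alliances\<close>

text \<open>This supplies the full factor of the rectangles: the part \<open>S\<close> through \<open>v\<close> already gives \<open>v\<close>
  at least \<open>k\<close> neighbours, and no neighbour lies outside the whole vertex set.\<close>

lemma global_alliance_partition_trivial:
  assumes G: "pair_graph G" and P: "global_alliance_partition G k P" and ne: "pverts G \<noteq> {}"
  shows "global_alliance_partition G k {pverts G}"
proof -
  interpret G: pair_graph G by fact
  have "k \<le> int (nbr_count G (pverts G) v)" if v: "v \<in> pverts G" for v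
  proof -
    obtain S where S: "S \<in> P" "v \<in> S"
      using P v by (auto simp: global_alliance_partition_def partition_on_def)
    then have "S \<subseteq> pverts G" "int (nbr_count G (pverts G - S) v) + k \<le> int (nbr_count G S v)"
      using P by (auto simp: global_alliance_partition_def global_defensive_alliance_def
          defensive_alliance_def)
    then show ?thesis
      using nbr_count_Diff[of "pverts G" S G v] by simp
  qed
  moreover have "nbr_count G {} v = 0" for v
    by (simp add: nbr_count_def)
  ultimately have "global_defensive_alliance G k (pverts G)"
    using ne by (simp add: global_defensive_alliance_def defensive_alliance_def dominating_set_def)
  then show ?thesis
    using ne by (simp add: global_alliance_partition_def partition_on_space)
qed

lemma partition_on_Times:
  assumes P: "partition_on A P" and Q: "partition_on B Q"
  shows "partition_on (A \<times> B) ((\<lambda>(S, T). S \<times> T) ` (P \<times> Q))"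
proof (rule partition_onI)
  show "\<Union> ((\<lambda>(S, T). S \<times> T) ` (P \<times> Q)) = A \<times> B"
    using partition_onD1[OF P] partition_onD1[OF Q] by auto
next
  show "{} \<notin> (\<lambda>(S, T). S \<times> T) ` (P \<times> Q)"
    using partition_onD3[OF P] partition_onD3[OF Q] by (auto simp: eq_commute[of "{}"])
next
  fix X Y
  assume "X \<in> (\<lambda>(S, T). S \<times> T) ` (P \<times> Q)" "Y \<in> (\<lambda>(S, T). S \<times> T) ` (P \<times> Q)" "X \<noteq> Y"
  then obtain S T S' T' where *: "S \<in> P" "S' \<in> P" "T \<in> Q" "T' \<in> Q" "X = S \<times> T" "Y = S' \<times> T'"
    and "S \<noteq> S' \<or> T \<noteq> T'"
    by auto
  then have "S \<inter> S' = {} \<or> T \<inter> T' = {}"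
    using partition_onD2[OF P] partition_onD2[OF Q] by (meson disjointD)
  then show "disjnt X Y"
    using * by (auto simp: disjnt_def)
qed

lemma card_Times_image:
  assumes "{} \<notin> P" "{} \<notin> Q"
  shows "card ((\<lambda>(S, T). S \<times> T) ` (P \<times> Q)) = card P * card Q"
proof -
  have "inj_on (\<lambda>(S, T). S \<times> T) (P \<times> Q)"
    using assms by (auto simp: inj_on_def times_eq_iff)
  then show ?thesis
    by (simp add: card_image card_cartesian_product)
qed

lemma global_alliance_partition_Times:
  assumes "pair_graph G" "pair_graph H"
    and "global_alliance_partition G k P" "global_alliance_partition H l Q"
    and "P = {pverts G} \<or> Q = {pverts H}"
  shows "global_alliance_partition (cartesian_product G H) (k + l)
           ((\<lambda>(S, T). S \<times> T) ` (P \<times> Q))"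
  using assms
  by (auto simp: global_alliance_partition_def partition_on_Times
      intro!: global_defensive_alliance_Times)

section \<open>The two graph parameters\<close>

lemma global_alliance_number_le:
  assumes "global_defensive_alliance G k S"
  shows "global_alliance_number G k \<le> enat (card S)"
  unfolding global_alliance_number_def using assms by (auto intro: INF_lower)

text \<open>On natural numbers a supremum bounds its members only when the set is bounded; here all the
  partitions live in the finite double power set of the vertices.\<close>

lemma card_le_global_alliance_partition_number:
  assumes "finite (pverts G)" "global_alliance_partition G k P"
  shows "card P \<le> global_alliance_partition_number G k"
proof -
  have "{P. global_alliance_partition G k P} \<subseteq> Pow (Pow (pverts G))"
    by (auto simp: global_alliance_partition_def partition_on_def)
  then have "finite {P. global_alliance_partition G k P}"
    using assms(1) by (meson finite_Pow_iff finite_subset)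
  then show ?thesis
    unfolding global_alliance_partition_number_def using assms(2)
    by (intro cSUP_upper) auto
qed

lemma global_alliance_partition_number_le:
  assumes "global_alliance_partition G k P0"
    and "\<And>P. global_alliance_partition G k P \<Longrightarrow> card P \<le> m"
  shows "global_alliance_partition_number G k \<le> m"
  unfolding global_alliance_partition_number_def using assms by (intro cSUP_least) auto

lemma smallest_part:
  assumes "card P \<ge> 1"
  obtains S where "S \<in> P" "card S = Min (card ` P)"
proof -
  have "finite P" "P \<noteq> {}"
    using assms by (auto intro: card_ge_0_finite)
  then have "Min (card ` P) \<in> card ` P"
    by (intro Min_in) auto
  then show ?thesis
    using that by auto
qed

theorem theorem14:
  fixes \<Gamma>\<^sub>1 :: "'a pair_pre_digraph" and \<Gamma>\<^sub>2 :: "'b pair_pre_digraph"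
    and n\<^sub>1 n\<^sub>2 r\<^sub>1 r\<^sub>2 x\<^sub>1 x\<^sub>2 :: nat and k\<^sub>1 k\<^sub>2 :: int
    and \<Pi>\<^sub>1 :: "'a set set" and \<Pi>\<^sub>2 :: "'b set set"
  assumes "pair_graph \<Gamma>\<^sub>1" and "pair_graph \<Gamma>\<^sub>2"
    and "n\<^sub>1 = card (pverts \<Gamma>\<^sub>1)" and "n\<^sub>2 = card (pverts \<Gamma>\<^sub>2)"
    and "global_alliance_partition \<Gamma>\<^sub>1 k\<^sub>1 \<Pi>\<^sub>1" and "global_alliance_partition \<Gamma>\<^sub>2 k\<^sub>2 \<Pi>\<^sub>2"
    and "card \<Pi>\<^sub>1 = r\<^sub>1" and "card \<Pi>\<^sub>2 = r\<^sub>2"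
    and "1 \<le> r\<^sub>1" and "1 \<le> r\<^sub>2" and "r\<^sub>1 \<le> r\<^sub>2"
    and "x\<^sub>1 = Min (card ` \<Pi>\<^sub>1)" and "x\<^sub>2 = Min (card ` \<Pi>\<^sub>2)"
  shows "global_alliance_number (cartesian_product \<Gamma>\<^sub>1 \<Gamma>\<^sub>2) (k\<^sub>1 + k\<^sub>2)
           \<le> enat (min (x\<^sub>1 * n\<^sub>2) (x\<^sub>2 * n\<^sub>1))
       \<and> global_alliance_partition_number (cartesian_product \<Gamma>\<^sub>1 \<Gamma>\<^sub>2) (k\<^sub>1 + k\<^sub>2)
           \<ge> max (global_alliance_partition_number \<Gamma>\<^sub>1 k\<^sub>1)
                 (global_alliance_partition_number \<Gamma>\<^sub>2 k\<^sub>2)"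
proof -
  have \<Gamma>: "pair_graph \<Gamma>\<^sub>1" "pair_graph \<Gamma>\<^sub>2" by fact+
  interpret \<Gamma>\<^sub>1: pair_graph \<Gamma>\<^sub>1 by fact
  interpret \<Gamma>\<^sub>2: pair_graph \<Gamma>\<^sub>2 by fact
  let ?C = "cartesian_product \<Gamma>\<^sub>1 \<Gamma>\<^sub>2"
  let ?V\<^sub>1 = "pverts \<Gamma>\<^sub>1" and ?V\<^sub>2 = "pverts \<Gamma>\<^sub>2"
  obtain S where S: "S \<in> \<Pi>\<^sub>1" "card S = x\<^sub>1"
    using assms smallest_part[of \<Pi>\<^sub>1] by metis
  obtain T where T: "T \<in> \<Pi>\<^sub>2" "card T = x\<^sub>2"
    using assms smallest_part[of \<Pi>\<^sub>2] by metis
  have alliances: "global_defensive_alliance \<Gamma>\<^sub>1 k\<^sub>1 S" "global_defensive_alliance \<Gamma>\<^sub>2 k\<^sub>2 T"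
    using S T assms by (auto simp: global_alliance_partition_def)
  then have ne: "?V\<^sub>1 \<noteq> {}" "?V\<^sub>2 \<noteq> {}"
    by (auto simp: global_defensive_alliance_def defensive_alliance_def)
  have full: "global_alliance_partition \<Gamma>\<^sub>1 k\<^sub>1 {?V\<^sub>1}" "global_alliance_partition \<Gamma>\<^sub>2 k\<^sub>2 {?V\<^sub>2}"
    using assms ne by (auto intro: global_alliance_partition_trivial)
  then have "global_defensive_alliance ?C (k\<^sub>1 + k\<^sub>2) (S \<times> ?V\<^sub>2)"
    "global_defensive_alliance ?C (k\<^sub>1 + k\<^sub>2) (?V\<^sub>1 \<times> T)"
    using alliances by (auto simp: global_alliance_partition_def
        intro!: global_defensive_alliance_Times \<Gamma>)
  from this[THEN global_alliance_number_le]
  have number: "global_alliance_number ?C (k\<^sub>1 + k\<^sub>2) \<le> enat (min (x\<^sub>1 * n\<^sub>2) (x\<^sub>2 * n\<^sub>1))"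
    using S T assms by (simp add: card_cartesian_product min_def mult.commute)
  have bound: "card P * card Q \<le> global_alliance_partition_number ?C (k\<^sub>1 + k\<^sub>2)"
    if P: "global_alliance_partition \<Gamma>\<^sub>1 k\<^sub>1 P" and Q: "global_alliance_partition \<Gamma>\<^sub>2 k\<^sub>2 Q"
      and "P = {?V\<^sub>1} \<or> Q = {?V\<^sub>2}" for P Q
  proof -
    have "{} \<notin> P" "{} \<notin> Q"
      using P Q by (auto simp: global_alliance_partition_def partition_on_def)
    then show ?thesis
      using card_le_global_alliance_partition_number[OF _
          global_alliance_partition_Times[OF \<Gamma> that]]
      by (simp add: card_Times_image)
  qed
  have "global_alliance_partition_number \<Gamma>\<^sub>1 k\<^sub>1 \<le> global_alliance_partition_number ?C (k\<^sub>1 + k\<^sub>2)"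
    using full(1) bound[OF _ full(2)] by (intro global_alliance_partition_number_le) auto
  moreover have
    "global_alliance_partition_number \<Gamma>\<^sub>2 k\<^sub>2 \<le> global_alliance_partition_number ?C (k\<^sub>1 + k\<^sub>2)"
    using full(2) bound[OF full(1)] by (intro global_alliance_partition_number_le) auto
  ultimately show ?thesis
    using number by simp
qed

end
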